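(* Let $\mathcal{T}$ be the raster scan group and let $S=\{\mathbf{t}_j=j\mathbf{v}: j=0,\dots,s-1\}$ be any cyclic subgroup of $\mathcal{T}$ generated by $\mathbf{v}$, of order $s$ (so $s\mathbf{v}=0 \bmod n$). Write $\mu^k,\nu^k,f^k,g^k,\mathcal{M}^k$ for the $\mathbf{t}_k$-shifted quantities, with the index $k$ taken modulo $s$. Suppose that for some real numbers $\theta_0,\dots,\theta_{s-1}$ $$\nu^k(\mathbf{n})\,g^k(\mathbf{n})=e^{\mathrm{i}\theta_k}\mu^k(\mathbf{n})\,f^k(\mathbf{n})\qquad\text{for all }\mathbf{n}\in\mathcal{M}^k,\ k=0,\dots,s-1.$$ If, for all $k=0,\dots,s-1$, $$\mathcal{M}^{k}\cap\mathcal{M}^{k+1}\cap\operatorname{supp}(f)\cap(\operatorname{supp}(f)+\mathbf{v})\neq\emptyset,$$ then, modulo $2\pi$, the sequence $\{\theta_0,\theta_1,\dots,\theta_{s-1}\}$ is an arithmetic progression whose common difference $\Delta\theta=\theta_k-\theta_{k-1}$ is an integer multiple of $2\pi/s$.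
   Context: Let $m<n$ be positive integers. The object domain is $\mathbb{Z}_n^2=\{0,\dots,n-1\}^2$ with periodic boundary condition, i.e. all additions of pixel positions and shifts are modulo $n$ in each coordinate. The object is $f:\mathbb{Z}_n^2\to\mathbb{C}$ and $\operatorname{supp}(f)=\{\mathbf{n}: f(\mathbf{n})\ne 0\}$. The initial probe area is $\mathcal{M}^{00}=\{0,\dots,m-1\}^2\subset\mathbb{Z}_n^2$; the probe $\mu^{00}$ is a complex-valued function whose support is exactly $\mathcal{M}^{00}$ (nonzero at every pixel of $\mathcal{M}^{00}$, zero outside). A probe estimate is any function $\nu^{00}$ on $\mathcal{M}^{00}$ (zero outside) and an object estimate is any $g:\mathbb{Z}_n^2\to\mathbb{C}$. For a shift $\mathbf{t}$: $\mathcal{M}^{\mathbf{t}}=\mathcal{M}^{00}+\mathbf{t}$, $\mu^{\mathbf{t}}(\mathbf{n})=\mu^{00}(\mathbf{n}-\mathbf{t})$, $\nu^{\mathbf{t}}(\mathbf{n})=\nu^{00}(\mathbf{n}-\mathbf{t})$, and $f^{\mathbf{t}},g^{\mathbf{t}}$ are the restrictions of $f,g$ to $\mathcal{M}^{\mathbf{t}}$. The raster scan with step size $\tau=n/q$ ($\tau,q\in\mathbb{N}$) is $\mathcal{T}=\{\tau(k,l): k,l=0,\dots,q-1\}$, a group under addition modulo $n$. *)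

theory Defs
  imports "HOL-Analysis.Analysis" "HOL-Algebra.Algebra" "HOL-Library.Real_Mod"
begin

text \<open>
  The group structure of \<open>torus n\<close> (for \<open>n > 0\<close>, its carrier is \<open>{0..<n} \<times> {0..<n}\<close>) is addition
  modulo \<open>n\<close> in each coordinate. Objects and probes are total functions \<open>int \<times> int \<Rightarrow> complex\<close>;
  every definition below only looks at their values on the carrier.
\<close>

definition torus :: "nat \<Rightarrow> (int \<times> int) monoid" where
  "torus n = integer_mod_group n \<times>\<times> integer_mod_group n"

definition supp :: "nat \<Rightarrow> (int \<times> int \<Rightarrow> complex) \<Rightarrow> (int \<times> int) set" where
  "supp n f = {x \<in> carrier (torus n). f x \<noteq> 0}"

definition initial_area :: "nat \<Rightarrow> (int \<times> int) set" where
  "initial_area m = {0..<int m} \<times> {0..<int m}"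

definition probe_area :: "nat \<Rightarrow> nat \<Rightarrow> int \<times> int \<Rightarrow> (int \<times> int) set" where
  "probe_area n m t = initial_area m #>\<^bsub>torus n\<^esub> t"

definition shifted_probe ::
    "nat \<Rightarrow> (int \<times> int \<Rightarrow> complex) \<Rightarrow> int \<times> int \<Rightarrow> int \<times> int \<Rightarrow> complex" where
  "shifted_probe n \<mu> t = (\<lambda>x. \<mu> (x \<otimes>\<^bsub>torus n\<^esub> inv\<^bsub>torus n\<^esub> t))"

definition object_part ::
    "nat \<Rightarrow> nat \<Rightarrow> (int \<times> int \<Rightarrow> complex) \<Rightarrow> int \<times> int \<Rightarrow> int \<times> int \<Rightarrow> complex" where
  "object_part n m f t = restrict f (probe_area n m t)"

text \<open>
  With \<open>n = \<tau> * q\<close> the representatives below already lie in \<open>{0..<n} \<times> {0..<n}\<close>, so no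
  reduction modulo \<open>n\<close> is needed.
\<close>

definition raster :: "nat \<Rightarrow> nat \<Rightarrow> (int \<times> int) set" where
  "raster \<tau> q = {(int (\<tau> * k), int (\<tau> * l)) | k l. k < q \<and> l < q}"

definition raster_group :: "nat \<Rightarrow> nat \<Rightarrow> nat \<Rightarrow> (int \<times> int) monoid" where
  "raster_group n \<tau> q = (torus n)\<lparr>carrier := raster \<tau> q\<rparr>"

lemma carrier_torus: "n > 0 \<Longrightarrow> carrier (torus n) = {0..<int n} \<times> {0..<int n}"
  by (simp add: torus_def carrier_integer_mod_group)

lemma mult_torus: "(a, b) \<otimes>\<^bsub>torus n\<^esub> (c, d) = ((a + c) mod int n, (b + d) mod int n)"
  by (simp add: torus_def)

lemma group_torus: "group (torus n)"
  by (simp add: torus_def DirProd_group)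

lemma inv_torus:
  "(a, b) \<in> carrier (torus n) \<Longrightarrow> inv\<^bsub>torus n\<^esub> (a, b) = ((- a) mod int n, (- b) mod int n)"
  by (auto simp: torus_def inv_DirProd)

lemma pow_torus:
  "(a, b) [^]\<^bsub>torus n\<^esub> (j :: nat) = ((int j * a) mod int n, (int j * b) mod int n)"
proof (induction j)
  case 0
  then show ?case by (simp add: torus_def)
next
  case (Suc j)
  have "(int j * c mod int n + c) mod int n = int (Suc j) * c mod int n" for c
  proof -
    have "int (Suc j) * c = int j * c + c" by (simp add: distrib_right)
    then show ?thesis by (simp only: mod_add_left_eq)
  qed
  with Suc show ?case by (simp add: nat_pow_Suc mult_torus)
qed

lemma raster_alt:
  assumes "n = \<tau> * q" "n > 0"
  shows "raster \<tau> q = {(x, y) \<in> carrier (torus n). int \<tau> dvd x \<and> int \<tau> dvd y}"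
proof -
  have *: "(\<exists>k<q. x = int (\<tau> * k)) \<longleftrightarrow> 0 \<le> x \<and> x < int n \<and> int \<tau> dvd x" for x
  proof (intro iffI)
    assume "\<exists>k<q. x = int (\<tau> * k)"
    then obtain k where k: "k < q" "x = int (\<tau> * k)" by blast
    have "\<tau> * k < n" using k(1) assms by simp
    then show "0 \<le> x \<and> x < int n \<and> int \<tau> dvd x"
      unfolding k(2) by (simp only: of_nat_less_iff of_nat_0_le_iff int_dvd_int_iff dvd_triv_left)
  next
    assume R: "0 \<le> x \<and> x < int n \<and> int \<tau> dvd x"
    then have "\<tau> dvd nat x" by (metis int_dvd_int_iff nat_0_le)
    then obtain k where k: "nat x = \<tau> * k" by (rule dvdE)
    have "\<tau> * k < \<tau> * q" using R k assms(1) by linarith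
    then have "k < q" by simp
    moreover have "x = int (\<tau> * k)" using R k by linarith
    ultimately show "\<exists>k<q. x = int (\<tau> * k)" by blast
  qed
  have "(x, y) \<in> raster \<tau> q \<longleftrightarrow> (\<exists>k<q. x = int (\<tau> * k)) \<and> (\<exists>l<q. y = int (\<tau> * l))" for x y
    unfolding raster_def by blast
  then show ?thesis
    unfolding * carrier_torus[OF assms(2)] by auto
qed

lemma subgroup_raster:
  assumes "n = \<tau> * q" "n > 0"
  shows "subgroup (raster \<tau> q) (torus n)"
proof -
  have mem: "(x mod int n, y mod int n) \<in> raster \<tau> q" if "int \<tau> dvd x" "int \<tau> dvd y" for x y
  proof -
    have "int \<tau> dvd int n" using assms(1) by (simp only: int_dvd_int_iff dvd_triv_left)
    then show ?thesis
      using that assms(2)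
      unfolding raster_alt[OF assms] carrier_torus[OF assms(2)] by (simp add: dvd_mod)
  qed
  show ?thesis
  proof (rule group.subgroupI[OF group_torus])
    show "raster \<tau> q \<subseteq> carrier (torus n)"
      unfolding raster_alt[OF assms] by blast
    show "raster \<tau> q \<noteq> {}"
      using mem[of 0 0] by blast
  next
    fix a assume a: "a \<in> raster \<tau> q"
    obtain x y where xy: "a = (x, y)" by (cases a)
    have "(x, y) \<in> carrier (torus n)" "int \<tau> dvd x" "int \<tau> dvd y"
      using a unfolding raster_alt[OF assms] xy by blast+
    then show "inv\<^bsub>torus n\<^esub> a \<in> raster \<tau> q"
      unfolding xy by (simp only: inv_torus mem dvd_minus_iff)
  next
    fix a b assume ab: "a \<in> raster \<tau> q" "b \<in> raster \<tau> q"
    obtain x y x' y' where xy: "a = (x, y)" "b = (x', y')" by (cases a, cases b)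
    have "int \<tau> dvd x" "int \<tau> dvd y" "int \<tau> dvd x'" "int \<tau> dvd y'"
      using ab unfolding raster_alt[OF assms] xy by blast+
    then show "a \<otimes>\<^bsub>torus n\<^esub> b \<in> raster \<tau> q"
      unfolding xy mult_torus by (simp only: mem dvd_add)
  qed
qed

lemma group_raster_group: "n = \<tau> * q \<Longrightarrow> n > 0 \<Longrightarrow> group (raster_group n \<tau> q)"
  unfolding raster_group_def
  by (rule group.subgroup_imp_group[OF group_torus subgroup_raster])

end

theory Submission
  imports Defs
begin

text \<open>
  If a point \<open>x = y + v\<close> with \<open>f x \<noteq> 0 \<noteq> f y\<close> lies in the probe areas number \<open>k + 1\<close> and
  \<open>k + 2\<close>, then \<open>y\<close> lies in the areas number \<open>k\<close> and \<open>k + 1\<close>, and the two pairs of probe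
  pixels hit are the same. The four data equations at \<open>x\<close> and \<open>y\<close> therefore involve the same
  two probe ratios, and eliminating these gives
  \<open>2 \<theta>\<^sub>k\<^sub>+\<^sub>1 \<equiv> \<theta>\<^sub>k + \<theta>\<^sub>k\<^sub>+\<^sub>2\<close> modulo \<open>2 \<pi>\<close>. So the increments agree, and summing them once around the
  cycle of length \<open>s\<close> shows that \<open>s \<Delta>\<theta>\<close> is a multiple of \<open>2 \<pi>\<close>.
\<close>

lemma exp_i_eq_imp_rcong:
  assumes "exp (\<i> * of_real a) = exp (\<i> * of_real b)"
  shows "[a = b] (rmod (2 * pi))"
proof -
  obtain n :: int where n: "\<i> * of_real a = \<i> * of_real b + (of_int (2 * n) * pi) * \<i>"
    using assms unfolding exp_eq by blast
  have "Im (\<i> * of_real a) = Im (\<i> * of_real b + (of_int (2 * n) * pi) * \<i>)"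
    by (simp only: n)
  then have "b = a + of_int (- n) * (2 * pi)" by simp
  then show ?thesis unfolding rcong_altdef by blast
qed

text \<open>By induction every increment is congruent to the first one, \<open>\<Delta>\<close>, so
  \<open>\<phi> k\<close> is congruent to \<open>\<phi> 0 + k * \<Delta>\<close>; closing the cycle
  at \<open>k = s\<close> then quantizes \<open>\<Delta>\<close>.\<close>

lemma rcong_cyclic_progression:
  fixes \<phi> :: "nat \<Rightarrow> real"
  assumes "0 < s" and "\<phi> s = \<phi> 0"
    and step: "\<And>k. [\<phi> (k + 2) - \<phi> (k + 1) = \<phi> (k + 1) - \<phi> k] (rmod c)"
  shows "\<exists>p::int. \<forall>k. [\<phi> (k + 1) - \<phi> k = of_int p * (c / real s)] (rmod c)"
proof -
  define \<Delta> where "\<Delta> = \<phi> 1 - \<phi> 0"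
  have incr: "[\<phi> (k + 1) - \<phi> k = \<Delta>] (rmod c)" for k
  proof (induction k)
    case 0
    then show ?case by (simp add: \<Delta>_def)
  next
    case (Suc k)
    have "[\<phi> (Suc k + 1) - \<phi> (Suc k) = \<phi> (k + 1) - \<phi> k] (rmod c)"
      using step[of k] by simp
    then show ?case using Suc by (rule rcong_trans)
  qed
  have "[\<phi> k = \<phi> 0 + real k * \<Delta>] (rmod c)" for k
  proof (induction k)
    case 0
    then show ?case by simp
  next
    case (Suc k)
    have "[(\<phi> (k + 1) - \<phi> k) + \<phi> k = \<Delta> + (\<phi> 0 + real k * \<Delta>)] (rmod c)"
      by (rule rcong_add[OF incr Suc])
    then show ?case by (simp add: algebra_simps)
  qed
  \<comment> \<open>Since \<open>\<phi> s = \<phi> 0\<close>, this is the exact real equation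
    \<open>s * \<Delta> = p * c\<close>, so division by \<open>s\<close> is legitimate.\<close>
  from this[of s] obtain p :: int where "\<phi> 0 + real s * \<Delta> = \<phi> s + of_int p * c"
    unfolding rcong_altdef by blast
  then have "\<Delta> = of_int p * (c / real s)"
    using assms(1,2) by (simp add: field_simps)
  with incr show ?thesis by blast
qed

text \<open>Cancellation in the group yields two points and two probe pixels whose four data
  equations determine the second difference of \<open>\<phi>\<close>. \<open>A\<close> stands for
  the initial area, \<open>F\<close> for the support of the object.\<close>

lemma (in group) phase_increment_eq:
  fixes f g \<mu> \<nu> :: "'a \<Rightarrow> complex" and \<phi> :: "nat \<Rightarrow> real"
  assumes A: "A \<subseteq> carrier G" and v: "v \<in> carrier G" and F: "F \<subseteq> carrier G"
    and \<mu>: "\<And>a. a \<in> A \<Longrightarrow> \<mu> a \<noteq> 0" and f: "\<And>x. x \<in> F \<Longrightarrow> f x \<noteq> 0"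
    and eq: "\<And>k a. a \<in> A \<Longrightarrow> \<nu> a * g (a \<otimes> v [^] (k::nat))
               = exp (\<i> * of_real (\<phi> k)) * \<mu> a * f (a \<otimes> v [^] k)"
    and overlap: "(A #> v [^] (k + 1)) \<inter> (A #> v [^] (k + 2)) \<inter> F \<inter> (F #> v) \<noteq> {}"
  shows "[\<phi> (k + 2) - \<phi> (k + 1) = \<phi> (k + 1) - \<phi> k] (rmod (2 * pi))"
proof -
  \<comment> \<open>The overlap point is \<open>y \<otimes> v\<close>; \<open>a\<close> and
    \<open>b\<close> are the probe pixels that the two shifts place on it.\<close>
  obtain a b y where ab: "a \<in> A" "b \<in> A" and y: "y \<in> F" and xF: "y \<otimes> v \<in> F"
    and xa: "y \<otimes> v = a \<otimes> v [^] (k + 1)" and xb: "y \<otimes> v = b \<otimes> v [^] (k + 2)"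
    using overlap unfolding r_coset_def by fastforce
  have carr: "a \<in> carrier G" "b \<in> carrier G" "y \<in> carrier G" using ab y A F by auto
  have shift: "y = c \<otimes> v [^] j" if "y \<otimes> v = c \<otimes> v [^] (Suc j)" "c \<in> carrier G" for c and j :: nat
  proof -
    have "y \<otimes> v = (c \<otimes> v [^] j) \<otimes> v" using that v by (simp add: m_assoc)
    then show ?thesis using carr v that(2) by simp
  qed
  have ya: "y = a \<otimes> v [^] k" and yb: "y = b \<otimes> v [^] (k + 1)"
    using shift[of a k] shift[of b "k + 1"] xa xb carr by simp_all
  define e where "e j = exp (\<i> * of_real (\<phi> j))" for j
  have eqs: "\<nu> a * g (y \<otimes> v) = e (k + 1) * \<mu> a * f (y \<otimes> v)"
    "\<nu> b * g (y \<otimes> v) = e (k + 2) * \<mu> b * f (y \<otimes> v)"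
    "\<nu> a * g y = e k * \<mu> a * f y"
    "\<nu> b * g y = e (k + 1) * \<mu> b * f y"
    using eq[OF ab(1), of "k + 1"] eq[OF ab(2), of "k + 2"] eq[OF ab(1), of k]
      eq[OF ab(2), of "k + 1"]
    unfolding e_def xa[symmetric] xb[symmetric] ya[symmetric] yb[symmetric] by simp_all
  define P where "P = \<mu> a * \<mu> b * f (y \<otimes> v) * f y"
  \<comment> \<open>The product of both \<open>\<nu>\<close> values and both \<open>g\<close> values
    is paired in two ways, and the data equations evaluate each pairing. The common factor
    \<open>P\<close> is nonzero.\<close>
  have "e (k + 2) * e k * P = (\<nu> b * g (y \<otimes> v)) * (\<nu> a * g y)"
    unfolding P_def eqs by (simp add: mult_ac)
  also have "\<dots> = (\<nu> a * g (y \<otimes> v)) * (\<nu> b * g y)" by (simp add: mult_ac)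
  also have "\<dots> = e (k + 1) * e (k + 1) * P"
    unfolding P_def eqs by (simp add: mult_ac)
  finally have "e (k + 2) * e k = e (k + 1) * e (k + 1)"
    using \<mu> ab f y xF by (simp add: P_def)
  then have "exp (\<i> * of_real (\<phi> (k + 2) + \<phi> k)) = exp (\<i> * of_real (\<phi> (k + 1) + \<phi> (k + 1)))"
    by (simp only: e_def of_real_add distrib_left exp_add)
  then have "[\<phi> (k + 2) + \<phi> k = \<phi> (k + 1) + \<phi> (k + 1)] (rmod (2 * pi))"
    by (rule exp_i_eq_imp_rcong)
  then have "[\<phi> (k + 2) + \<phi> k - (\<phi> (k + 1) + \<phi> k)
      = \<phi> (k + 1) + \<phi> (k + 1) - (\<phi> (k + 1) + \<phi> k)] (rmod (2 * pi))"
    by (simp only: rcong_diff_right_cancel)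
  then show ?thesis by simp
qed

theorem theorem3p1:
  fixes m n \<tau> q s :: nat
    and v :: "int \<times> int" and S :: "(int \<times> int) set"
    and f g \<mu> \<nu> :: "int \<times> int \<Rightarrow> complex"
    and \<theta> :: "nat \<Rightarrow> real"
  assumes "0 < m" and "m < n"
    and "n = \<tau> * q"
    and "supp n \<mu> = initial_area m"
    and "supp n \<nu> \<subseteq> initial_area m"
    and "subgroup S (raster_group n \<tau> q)"
    and "v \<in> raster \<tau> q"
    and "S = generate (raster_group n \<tau> q) {v}"
    and "s = card S"
    and "\<forall>k<s. \<forall>x\<in>probe_area n m (v [^]\<^bsub>torus n\<^esub> k).
           shifted_probe n \<nu> (v [^]\<^bsub>torus n\<^esub> k) x * object_part n m g (v [^]\<^bsub>torus n\<^esub> k) x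
         = exp (\<i> * of_real (\<theta> k)) *
           shifted_probe n \<mu> (v [^]\<^bsub>torus n\<^esub> k) x * object_part n m f (v [^]\<^bsub>torus n\<^esub> k) x"
    and "\<forall>k<s. probe_area n m (v [^]\<^bsub>torus n\<^esub> k)
             \<inter> probe_area n m (v [^]\<^bsub>torus n\<^esub> ((k + 1) mod s))
             \<inter> supp n f \<inter> (supp n f #>\<^bsub>torus n\<^esub> v) \<noteq> {}"
  shows "\<exists>\<Delta>\<theta>::real. (\<exists>p::int. \<Delta>\<theta> = of_int p * (2 * pi / real s))
           \<and> (\<forall>k<s. [\<theta> ((k + 1) mod s) - \<theta> k = \<Delta>\<theta>] (rmod (2 * pi)))"
proof -
  interpret group "torus n" by (rule group_torus)
  have n: "n > 0" using assms(1,2) by simp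
  have sub: "subgroup (raster \<tau> q) (torus n)" by (rule subgroup_raster[OF assms(3) n])
  have v: "v \<in> carrier (torus n)" using subgroup.subset[OF sub] assms(7) by blast
  have fin: "finite (carrier (torus n))" by (simp add: carrier_torus[OF n])
  \<comment> \<open>Generating in the subgroup or in the whole torus gives the same set, so
    \<open>s\<close> is the order of \<open>v\<close> and exponents of \<open>v\<close> matter only
    modulo \<open>s\<close>.\<close>
  have "S = generate (torus n) {v}"
    using generate_consistent[OF _ sub, of "{v}"] assms(7,8) unfolding raster_group_def by simp
  then have s: "s = ord v"
    using generate_pow_card[OF v] assms(9) by simp
  have s0: "0 < s" using ord_ge_1[OF fin v] s by simp
  have pow_mod: "v [^]\<^bsub>torus n\<^esub> (k mod s) = v [^]\<^bsub>torus n\<^esub> k" for k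
  proof -
    have "v [^]\<^bsub>torus n\<^esub> (s * (k div s) + k mod s)
        = (v [^]\<^bsub>torus n\<^esub> s) [^]\<^bsub>torus n\<^esub> (k div s) \<otimes>\<^bsub>torus n\<^esub> v [^]\<^bsub>torus n\<^esub> (k mod s)"
      using v by (simp add: nat_pow_mult nat_pow_pow)
    also have "\<dots> = v [^]\<^bsub>torus n\<^esub> (k mod s)"
      using v by (simp add: s)
    finally show ?thesis by simp
  qed
  define A where "A = initial_area m"
  have A: "A \<subseteq> carrier (torus n)"
    using assms(2) by (auto simp: A_def initial_area_def carrier_torus[OF n])
  \<comment> \<open>The \<open>s\<close>-periodic extension of \<open>\<theta>\<close> turns the
    cyclic index into an ordinary natural number.\<close>
  define \<phi> where "\<phi> k = \<theta> (k mod s)" for k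
  have data: "\<nu> a * g (a \<otimes>\<^bsub>torus n\<^esub> v [^]\<^bsub>torus n\<^esub> k)
      = exp (\<i> * of_real (\<phi> k)) * \<mu> a * f (a \<otimes>\<^bsub>torus n\<^esub> v [^]\<^bsub>torus n\<^esub> k)"
    if a: "a \<in> A" for a and k :: nat
  proof -
    have ac: "a \<in> carrier (torus n)" using a A by blast
    let ?t = "v [^]\<^bsub>torus n\<^esub> k"
    let ?x = "a \<otimes>\<^bsub>torus n\<^esub> ?t"
    have x: "?x \<in> probe_area n m ?t"
      using a unfolding probe_area_def A_def r_coset_def by blast
    \<comment> \<open>At \<open>a\<close> moved by \<open>?t\<close> the shifted probes take their
      unshifted values at \<open>a\<close>.\<close>
    have unshift: "?x \<otimes>\<^bsub>torus n\<^esub> inv\<^bsub>torus n\<^esub> ?t = a"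
      using ac v by (simp add: m_assoc)
    have "k mod s < s" using s0 by simp
    from assms(10)[rule_format, OF this, unfolded pow_mod, OF x] show ?thesis
      using x unfolding shifted_probe_def object_part_def unshift \<phi>_def by simp
  qed
  have overlap: "(A #>\<^bsub>torus n\<^esub> v [^]\<^bsub>torus n\<^esub> k) \<inter> (A #>\<^bsub>torus n\<^esub> v [^]\<^bsub>torus n\<^esub> (k + 1))
      \<inter> supp n f \<inter> (supp n f #>\<^bsub>torus n\<^esub> v) \<noteq> {}" for k :: nat
  proof -
    have "(k mod s + 1) mod s = (k + 1) mod s" by (rule mod_add_left_eq)
    moreover have "k mod s < s" using s0 by simp
    ultimately show ?thesis
      using assms(11)[rule_format, of "k mod s"] unfolding probe_area_def A_def
      by (simp only: pow_mod not_False_eq_True)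
  qed
  have "[\<phi> (k + 2) - \<phi> (k + 1) = \<phi> (k + 1) - \<phi> k] (rmod (2 * pi))" for k
  \<comment> \<open>The areas met here have numbers \<open>k + 1\<close> and \<open>k + 2\<close>,
    hence the overlap at \<open>k + 1\<close>.\<close>
  proof (rule phase_increment_eq[OF A v])
    show "supp n f \<subseteq> carrier (torus n)" by (auto simp: supp_def)
    show "\<mu> a \<noteq> 0" if "a \<in> A" for a
      using that unfolding A_def assms(4)[symmetric] supp_def by simp
    show "f x \<noteq> 0" if "x \<in> supp n f" for x
      using that by (simp add: supp_def)
  qed (use data overlap[of "k + 1"] in \<open>simp_all add: add.assoc\<close>)
  from rcong_cyclic_progression[of s \<phi>, OF s0 _ this] obtain p :: int
    where p: "\<And>k. [\<phi> (k + 1) - \<phi> k = of_int p * (2 * pi / real s)] (rmod (2 * pi))"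
    by (auto simp: \<phi>_def)
  have "[\<theta> ((k + 1) mod s) - \<theta> k = of_int p * (2 * pi / real s)] (rmod (2 * pi))" if "k < s" for k
    using p[of k] that by (simp add: \<phi>_def)
  then show ?thesis by blast
qed

end
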